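(* Let $t\in\mathbb{N}$, let $f:2^\Omega\to\mathbb{R}$ be a set function with $\Omega=\{1,\dots,n\}$, and let $F$ be its multilinear extension. Then $f$ is $t$-sos-submodular if and only if, for every $i\in\{1,\dots,n\}$, the polynomial $\frac{\partial F(x)}{\partial x_i}-\frac{\partial F(y)}{\partial x_i}$ is $(t+1)$-sos modulo $I_1[x_{-i},y_{-i}]$.
   Context: $\mathbb{N}$ includes $0$. The multilinear extension (MLE) of a set function $f:2^\Omega\to\mathbb{R}$ is the unique multilinear polynomial $F\in\mathbb{R}[x_1,\dots,x_n]$ (every variable appears with power at most $1$ in every monomial) with $F(1_S)=f(S)$ for all $S\subseteq\Omega$, where $1_S\in\{0,1\}^n$ is the indicator vector of $S$. $\frac{\partial F(y)}{\partial x_i}$ denotes the partial derivative of $F$ with respect to its $i$-th argument, evaluated at $y=(y_1,\dots,y_n)$. For an ideal $I$ of a real polynomial ring, a polynomial $p$ is $t$-sos modulo $I$ if there are finitely many polynomials $q_1,\dots,q_m$ in that ring, each of degree at most $t$, with $p-\sum_{r=1}^m q_r^2\in I$. For $i\ne j$, $x_{-i,j}$ denotes the variables $x_1,\dots,x_n$ with $x_i,x_j$ removed, and $I_2[x_{-i,j}]=\langle x_k^2-x_k : k\neq i,j\rangle\subseteq\mathbb{R}[x_{-i,j}]$. The set function $f$ with MLE $F$ is $t$-sos-submodular if for all $i\neq j$ the polynomial $-\frac{\partial^2F(x)}{\partial x_i\partial x_j}$ (which does not involve $x_i,x_j$) is $t$-sos modulo $I_2[x_{-i,j}]$. $x_{-i}$,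 $y_{-i}$ denote the variables $x$, $y$ with the $i$-th one removed, and $I_1[x_{-i},y_{-i}]=\langle \{x_k^2-x_k,\ x_ky_k-x_k,\ y_k^2-y_k\}_{k\ne i}\rangle\subseteq\mathbb{R}[x_{-i},y_{-i}]$. *)

theory Defs
  imports Complex_Main "HOL-Library.Poly_Mapping" "HOL-Library.Indicator_Function" "HOL-Algebra.Ideal"
begin

section \<open>Real polynomials in several variables\<close>

text \<open>A polynomial maps a monomial (an exponent vector with finite support) to its coefficient.
  The ring operations are the convolution-based instances of \<open>Poly_Mapping\<close>.\<close>

type_synonym 'v rpoly = "('v \<Rightarrow>\<^sub>0 nat) \<Rightarrow>\<^sub>0 real"

definition Var :: "'v \<Rightarrow> 'v rpoly" where
  "Var v = Poly_Mapping.single (Poly_Mapping.single v 1) 1"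

definition Const :: "real \<Rightarrow> 'v rpoly" where
  "Const c = Poly_Mapping.single 0 c"

definition vars :: "'v rpoly \<Rightarrow> 'v set" where
  "vars p = (\<Union>m\<in>Poly_Mapping.keys p. Poly_Mapping.keys m)"

definition mon_degree :: "('v \<Rightarrow>\<^sub>0 nat) \<Rightarrow> nat" where
  "mon_degree m = (\<Sum>v\<in>Poly_Mapping.keys m. Poly_Mapping.lookup m v)"

text \<open>The zero polynomial has total degree \<open>0\<close>, so it satisfies every bound
  \<open>total_degree p \<le> t\<close>.\<close>

definition total_degree :: "'v rpoly \<Rightarrow> nat" where
  "total_degree p = Max (insert 0 (mon_degree ` Poly_Mapping.keys p))"

definition poly_eval :: "('v \<Rightarrow> real) \<Rightarrow> 'v rpoly \<Rightarrow> real" where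
  "poly_eval a p = (\<Sum>m\<in>Poly_Mapping.keys p. Poly_Mapping.lookup p m *
     (\<Prod>v\<in>Poly_Mapping.keys m. a v ^ Poly_Mapping.lookup m v))"

definition poly_subst :: "('v \<Rightarrow> 'w rpoly) \<Rightarrow> 'v rpoly \<Rightarrow> 'w rpoly" where
  "poly_subst s p = (\<Sum>m\<in>Poly_Mapping.keys p. Const (Poly_Mapping.lookup p m) *
     (\<Prod>v\<in>Poly_Mapping.keys m. s v ^ Poly_Mapping.lookup m v))"

text \<open>The exponent subtraction below truncates at \<open>0\<close>, but only in terms whose coefficient
  is \<open>0\<close> as well.\<close>

definition partial_deriv :: "'v \<Rightarrow> 'v rpoly \<Rightarrow> 'v rpoly" where
  "partial_deriv v p = (\<Sum>m\<in>Poly_Mapping.keys p.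
     Poly_Mapping.single (m - Poly_Mapping.single v 1)
       (real (Poly_Mapping.lookup m v) * Poly_Mapping.lookup p m))"

text \<open>The polynomial ring in the variables from \<open>V\<close>, as a subring of the type \<open>'v rpoly\<close>.\<close>

definition poly_ring :: "'v set \<Rightarrow> 'v rpoly ring" where
  "poly_ring V = \<lparr>carrier = {p. vars p \<subseteq> V}, monoid.mult = (*), one = 1, zero = 0, add = (+)\<rparr>"

lemma vars_simps [simp]:
  "vars 0 = {}" "vars 1 = {}" "vars (- p) = vars p"
  by (auto simp: vars_def in_keys_iff)

lemma vars_add: "vars (p + q) \<subseteq> vars p \<union> vars q"
  unfolding vars_def using keys_add[of p q] by blast

lemma vars_mult: "vars (p * q) \<subseteq> vars p \<union> vars q"
proof
  fix v assume "v \<in> vars (p * q)"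
  then obtain m where m: "m \<in> Poly_Mapping.keys (p * q)" "v \<in> Poly_Mapping.keys m"
    by (auto simp: vars_def)
  then obtain a b where ab: "m = a + b" "a \<in> Poly_Mapping.keys p" "b \<in> Poly_Mapping.keys q"
    using keys_mult[of p q] by blast
  have "v \<in> Poly_Mapping.keys a \<union> Poly_Mapping.keys b"
    using m(2) ab(1) keys_add[of a b] by blast
  then show "v \<in> vars p \<union> vars q"
    using ab by (auto simp: vars_def)
qed

lemma cring_poly_ring: "cring (poly_ring V)"
proof (intro cringI abelian_groupI comm_monoidI)
  fix p assume p: "p \<in> carrier (poly_ring V)"
  show "\<exists>q\<in>carrier (poly_ring V). q \<oplus>\<^bsub>poly_ring V\<^esub> p = \<zero>\<^bsub>poly_ring V\<^esub>"
    using p by (intro bexI[of _ "- p"]) (auto simp: poly_ring_def)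
qed (auto simp: poly_ring_def algebra_simps dest: vars_add[THEN subsetD] vars_mult[THEN subsetD])


section \<open>Multilinear extensions\<close>

definition multilinear :: "'v rpoly \<Rightarrow> bool" where
  "multilinear p \<longleftrightarrow> (\<forall>m\<in>Poly_Mapping.keys p. \<forall>v. Poly_Mapping.lookup m v \<le> 1)"

text \<open>Only the values of \<open>f\<close> on subsets of \<open>{1..n}\<close> matter.\<close>

definition is_mle :: "nat \<Rightarrow> (nat set \<Rightarrow> real) \<Rightarrow> nat rpoly \<Rightarrow> bool" where
  "is_mle n f F \<longleftrightarrow> F \<in> carrier (poly_ring {1..n}) \<and> multilinear F \<and>
     (\<forall>S. S \<subseteq> {1..n} \<longrightarrow> poly_eval (indicator S) F = f S)"

definition mle :: "nat \<Rightarrow> (nat set \<Rightarrow> real) \<Rightarrow> nat rpoly" where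
  "mle n f = (THE F. is_mle n f F)"

definition sq_free_mon :: "nat set \<Rightarrow> (nat \<Rightarrow>\<^sub>0 nat)" where
  "sq_free_mon T = (\<Sum>k\<in>T. Poly_Mapping.single k 1)"

lemma lookup_sq_free_mon:
  "finite T \<Longrightarrow> Poly_Mapping.lookup (sq_free_mon T) v = (if v \<in> T then 1 else 0)"
  by (simp add: sq_free_mon_def lookup_sum lookup_single when_def)

lemma keys_sq_free_mon: "finite T \<Longrightarrow> Poly_Mapping.keys (sq_free_mon T) = T"
  by (auto simp: in_keys_iff lookup_sq_free_mon split: if_splits)

lemma sq_free_mon_keys:
  assumes "\<And>v. Poly_Mapping.lookup m v \<le> 1"
  shows "m = sq_free_mon (Poly_Mapping.keys m)"
proof (rule poly_mapping_eqI)
  fix v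
  show "Poly_Mapping.lookup m v = Poly_Mapping.lookup (sq_free_mon (Poly_Mapping.keys m)) v"
    using assms[of v] by (auto simp: lookup_sq_free_mon in_keys_iff)
qed

lemma inj_sq_free_mon: "inj_on sq_free_mon (Pow {1..n})"
  by (rule inj_onI) (metis PowD finite_atLeastAtMost finite_subset keys_sq_free_mon)

lemma multilinear_keys:
  assumes "vars F \<subseteq> {1..n}" "multilinear F"
  shows "Poly_Mapping.keys F \<subseteq> sq_free_mon ` Pow {1..n}"
proof
  fix m assume m: "m \<in> Poly_Mapping.keys F"
  have "m = sq_free_mon (Poly_Mapping.keys m)"
    using m assms(2) by (intro sq_free_mon_keys) (auto simp: multilinear_def)
  moreover have "Poly_Mapping.keys m \<subseteq> {1..n}"
    using m assms(1) by (auto simp: vars_def)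
  ultimately show "m \<in> sq_free_mon ` Pow {1..n}" by blast
qed

lemma poly_eval_indicator:
  assumes "Poly_Mapping.keys F \<subseteq> sq_free_mon ` Pow {1..n}" "S \<subseteq> {1..n}"
  shows "poly_eval (indicator S) F = (\<Sum>T\<in>Pow S. Poly_Mapping.lookup F (sq_free_mon T))"
proof -
  let ?g = "\<lambda>m. \<Prod>v\<in>Poly_Mapping.keys m. (indicator S v :: real) ^ Poly_Mapping.lookup m v"
  have g: "?g (sq_free_mon T) = (if T \<subseteq> S then 1 else 0)" if "T \<in> Pow {1..n}" for T
  proof -
    have fin: "finite T" using that by (auto intro: finite_subset)
    then have "?g (sq_free_mon T) = (\<Prod>v\<in>T. if v \<in> S then 1 else 0)"
      by (simp add: keys_sq_free_mon lookup_sq_free_mon indicator_def of_bool_def)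
    also have "\<dots> = (if T \<subseteq> S then 1 else 0)"
      proof (cases "T \<subseteq> S")
      case True
      then show ?thesis by (simp add: subset_iff)
    next
      case False
      then show ?thesis using fin by (auto intro!: prod_zero)
    qed
    finally show ?thesis .
  qed
  have "poly_eval (indicator S) F =
      (\<Sum>m\<in>sq_free_mon ` Pow {1..n}. Poly_Mapping.lookup F m * ?g m)"
    unfolding poly_eval_def using assms(1)
    by (intro sum.mono_neutral_left) (auto simp: in_keys_iff)
  also have "\<dots> = (\<Sum>T\<in>Pow {1..n}.
      Poly_Mapping.lookup F (sq_free_mon T) * ?g (sq_free_mon T))"
    using inj_sq_free_mon by (subst sum.reindex) (auto simp: o_def)
  also have "\<dots> = (\<Sum>T\<in>Pow {1..n}.
      if T \<subseteq> S then Poly_Mapping.lookup F (sq_free_mon T) else 0)"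
    by (intro sum.cong refl) (simp add: g)
  also have "\<dots> = (\<Sum>T\<in>Pow S. Poly_Mapping.lookup F (sq_free_mon T))"
    using assms(2) by (intro sum.mono_neutral_cong_right) auto
  finally show ?thesis .
qed

lemma ex1_mle: "\<exists>!F. is_mle n f F"
proof (rule ex_ex1I)
  define g :: "nat set \<Rightarrow> real" where
    "g T = (-1) ^ card T * (\<Sum>U\<in>Pow T. (-1) ^ card U * f U)" for T
  define F :: "nat rpoly" where
    "F = (\<Sum>T\<in>Pow {1..n}. Poly_Mapping.single (sq_free_mon T) (g T))"
  have look: "Poly_Mapping.lookup F (sq_free_mon T) = g T" if "T \<subseteq> {1..n}" for T
  proof -
    have "Poly_Mapping.lookup F (sq_free_mon T) =
        (\<Sum>U\<in>Pow {1..n}. if U = T then g U else 0)"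
      unfolding F_def lookup_sum lookup_single when_def
      using that inj_on_eq_iff[OF inj_sq_free_mon[of n]] by (intro sum.cong refl) (simp del: atLeastAtMost_iff)
    then show ?thesis using that by simp
  qed
  have keys: "Poly_Mapping.keys F \<subseteq> sq_free_mon ` Pow {1..n}"
  proof
    fix m assume "m \<in> Poly_Mapping.keys F"
    then have "(\<Sum>T\<in>Pow {1..n}. g T when sq_free_mon T = m) \<noteq> 0"
      by (simp add: F_def in_keys_iff lookup_sum lookup_single)
    then obtain T where "T \<in> Pow {1..n}" "(g T when sq_free_mon T = m) \<noteq> 0"
      by (rule sum.not_neutral_contains_not_neutral)
    then have "T \<in> Pow {1..n}" "m = sq_free_mon T"
      unfolding when_neq_zero by simp_all
    then show "m \<in> sq_free_mon ` Pow {1..n}" by (rule rev_image_eqI)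
  qed
  have sub: "\<exists>T. finite T \<and> T \<subseteq> {1..n} \<and> m = sq_free_mon T" if "m \<in> Poly_Mapping.keys F" for m
  proof -
    have "m \<in> sq_free_mon ` Pow {1..n}" using keys that by (rule subsetD)
    then obtain T where T: "T \<subseteq> {1..n}" "m = sq_free_mon T" by (auto elim: imageE)
    moreover have "finite T" using T(1) finite_atLeastAtMost by (rule finite_subset)
    ultimately show ?thesis by (intro exI conjI)
  qed
  have "vars F \<subseteq> {1..n}"
    unfolding vars_def
  proof (rule UN_least)
    fix m assume "m \<in> Poly_Mapping.keys F"
    then obtain T where "finite T" "T \<subseteq> {1..n}" "m = sq_free_mon T" using sub by blast
    then show "Poly_Mapping.keys m \<subseteq> {1..n}" by (simp only: keys_sq_free_mon)
  qed
  moreover have "multilinear F"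
    unfolding multilinear_def
  proof (intro ballI allI)
    fix m v assume "m \<in> Poly_Mapping.keys F"
    then obtain T where "finite T" "m = sq_free_mon T" using sub by blast
    then show "Poly_Mapping.lookup m v \<le> 1" by (simp add: lookup_sq_free_mon)
  qed
  moreover have "poly_eval (indicator S) F = f S" if S: "S \<subseteq> {1..n}" for S
  proof -
    have "poly_eval (indicator S) F = (\<Sum>T\<in>Pow S. g T)"
      unfolding poly_eval_indicator[OF keys S] using S by (intro sum.cong refl look) blast
    also have "\<dots> = f S"
    proof -
      have "f S = (\<Sum>T\<in>Pow S. (-1) ^ card T * (\<Sum>U\<in>Pow T. (-1) ^ card U * f U))"
        using finite_subset[OF S finite_atLeastAtMost]
        by (rule inclusion_exclusion_symmetric[rotated]) simp
      then show ?thesis by (simp add: g_def)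
    qed
    finally show ?thesis .
  qed
  ultimately show "\<exists>F. is_mle n f F"
    unfolding is_mle_def poly_ring_def by (intro exI[of _ F]) simp
next
  fix F G assume FG: "is_mle n f F" "is_mle n f G"
  have kF: "Poly_Mapping.keys F \<subseteq> sq_free_mon ` Pow {1..n}"
    and kG: "Poly_Mapping.keys G \<subseteq> sq_free_mon ` Pow {1..n}"
    using FG multilinear_keys by (auto simp: is_mle_def poly_ring_def)
  have eq: "Poly_Mapping.lookup F (sq_free_mon S) = Poly_Mapping.lookup G (sq_free_mon S)"
    if "finite S" "S \<subseteq> {1..n}" for S
    using that
  proof (induction S rule: finite_psubset_induct)
    case (psubset S)
    let ?d = "\<lambda>T. Poly_Mapping.lookup F (sq_free_mon T) - Poly_Mapping.lookup G (sq_free_mon T)"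
    have "(\<Sum>T\<in>Pow S. ?d T) = 0"
      using FG psubset.prems poly_eval_indicator[OF kF] poly_eval_indicator[OF kG]
      by (simp add: sum_subtractf is_mle_def)
    moreover have "(\<Sum>T\<in>Pow S. ?d T) = ?d S + (\<Sum>T\<in>Pow S - {S}. ?d T)"
      using psubset.hyps by (intro sum.remove) auto
    moreover have "(\<Sum>T\<in>Pow S - {S}. ?d T) = 0"
      using psubset.IH psubset.prems by (intro sum.neutral) auto
    ultimately show ?case by simp
  qed
  show "F = G"
  proof (rule poly_mapping_eqI)
    fix m
    show "Poly_Mapping.lookup F m = Poly_Mapping.lookup G m"
    proof (cases "m \<in> sq_free_mon ` Pow {1..n}")
      case True
      then obtain T where "T \<subseteq> {1..n}" "m = sq_free_mon T" by blast
      then show ?thesis using eq[of T] finite_subset[of T "{1..n}"] by simp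
    next
      case False
      then show ?thesis using kF kG by (metis in_keys_iff subsetD)
    qed
  qed
qed

lemma is_mle_mle: "is_mle n f (mle n f)"
  unfolding mle_def by (rule theI') (rule ex1_mle)


section \<open>Sums of squares modulo an ideal\<close>

text \<open>The ideal \<open>I\<close> and the polynomials that are squared live in the ring \<open>R[V]\<close>.\<close>

definition sos_mod :: "'v set \<Rightarrow> nat \<Rightarrow> 'v rpoly set \<Rightarrow> 'v rpoly \<Rightarrow> bool" where
  "sos_mod V t I p \<longleftrightarrow> (\<exists>(m::nat) q.
     (\<forall>r\<in>{1..m}. q r \<in> carrier (poly_ring V) \<and> total_degree (q r) \<le> t) \<and>
     p - (\<Sum>r=1..m. (q r)\<^sup>2) \<in> I)"

definition vars2 :: "nat \<Rightarrow> nat \<Rightarrow> nat \<Rightarrow> nat set" where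
  "vars2 n i j = {1..n} - {i, j}"

definition I2 :: "nat \<Rightarrow> nat \<Rightarrow> nat \<Rightarrow> nat rpoly set" where
  "I2 n i j = genideal (poly_ring (vars2 n i j)) ((\<lambda>k. (Var k)\<^sup>2 - Var k) ` vars2 n i j)"

definition sos_submodular :: "nat \<Rightarrow> nat \<Rightarrow> (nat set \<Rightarrow> real) \<Rightarrow> bool" where
  "sos_submodular t n f \<longleftrightarrow> (\<forall>i\<in>{1..n}. \<forall>j\<in>{1..n}. i \<noteq> j \<longrightarrow>
     sos_mod (vars2 n i j) t (I2 n i j) (- partial_deriv i (partial_deriv j (mle n f))))"

text \<open>Names for the two families of variables \<open>x\<^sub>k\<close> and \<open>y\<^sub>k\<close>.\<close>

datatype xy = X nat | Y nat

definition vars1 :: "nat \<Rightarrow> nat \<Rightarrow> xy set" where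
  "vars1 n i = X ` ({1..n} - {i}) \<union> Y ` ({1..n} - {i})"

definition I1 :: "nat \<Rightarrow> nat \<Rightarrow> xy rpoly set" where
  "I1 n i = genideal (poly_ring (vars1 n i))
     (\<Union>k\<in>{1..n} - {i}. {(Var (X k))\<^sup>2 - Var (X k),
                         Var (X k) * Var (Y k) - Var (X k),
                         (Var (Y k))\<^sup>2 - Var (Y k)})"

end

theory Submission
  imports Defs
begin

text \<open>
  Why the theorem holds. Both ideals contain \<open>v\<^sup>2 - v\<close> for each of their variables \<open>v\<close>.
  By Lagrange interpolation on the cube, a polynomial lies in such an ideal exactly when it vanishes
  at the real zeros of the generators (\<open>mem_genideal_iff_vanishing\<close>). Being a sum of squares modulo
  the ideal thus becomes an identity between values: at the \<open>0/1\<close> points for \<open>I2\<close>, and at the pairs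
  \<open>x \<le> y\<close> of \<open>0/1\<close> points for \<open>I1\<close>, since \<open>x\<^sub>k y\<^sub>k = x\<^sub>k\<close> says \<open>x\<^sub>k \<le> y\<^sub>k\<close> there.

  The equivalence holds for each \<open>i\<close> on its own. Let \<open>G = \<partial>F/\<partial>x\<^sub>i\<close>, which is multilinear.
  One side certifies that \<open>G\<close> is antitone, by squares that represent \<open>G(x) - G(y)\<close> for \<open>x \<le> y\<close>; the
  other side certifies this along every coordinate \<open>j\<close>, by squares that represent \<open>- \<partial>G/\<partial>x\<^sub>j\<close>.

  From local to global (\<open>sos_differences_imp_sos_antitone\<close>): walk from \<open>x\<close> to \<open>y\<close> by changing one
  coordinate at a time. The step at \<open>j\<close> contributes \<open>(y\<^sub>j - x\<^sub>j) (- \<partial>G/\<partial>x\<^sub>j)(z)\<close>, where each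
  coordinate of \<open>z\<close> is one of the \<open>x\<^sub>k\<close> or \<open>y\<^sub>k\<close>. As \<open>y\<^sub>j - x\<^sub>j\<close> equals its own square at the
  relevant points, the contribution is a sum of squares of polynomials whose degree is one higher.

  From global to local (\<open>sos_antitone_imp_sos_differences\<close>): set \<open>x = y\<close> outside \<open>j\<close> and
  \<open>(x\<^sub>j, y\<^sub>j) = (0, 1)\<close>. Then \<open>- \<partial>G/\<partial>x\<^sub>j\<close> is a sum of squares of polynomials \<open>q\<close> of degree at most
  \<open>t + 1\<close>, which is one too many. But \<open>G(x) - G(y)\<close> is zero when \<open>x = y\<close>, so every single \<open>q\<close> vanishes
  there because squares are nonnegative. The value of \<open>q\<close> at \<open>(0, 1)\<close> is therefore its difference
  between \<open>y\<^sub>j = 1\<close> and \<open>y\<^sub>j = 0\<close>, and only the monomials with \<open>y\<^sub>j\<close> contribute to it: erasing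
  \<open>y\<^sub>j\<close> from them leaves degree at most \<open>t\<close>.
\<close>

section \<open>Evaluation, variables and degree\<close>

definition mon_eval :: "('v \<Rightarrow> 'a::comm_monoid_mult) \<Rightarrow> ('v \<Rightarrow>\<^sub>0 nat) \<Rightarrow> 'a" where
  "mon_eval a m = (\<Prod>v\<in>Poly_Mapping.keys m. a v ^ Poly_Mapping.lookup m v)"

lemma mon_eval_superset:
  assumes "finite A" "Poly_Mapping.keys m \<subseteq> A"
  shows "mon_eval a m = (\<Prod>v\<in>A. a v ^ Poly_Mapping.lookup m v)"
  unfolding mon_eval_def using assms
  by (intro prod.mono_neutral_left) (auto simp: in_keys_iff)

lemma mon_eval_add: "mon_eval a (m + m') = mon_eval a m * mon_eval a m'"
proof -
  let ?A = "Poly_Mapping.keys m \<union> Poly_Mapping.keys m'"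
  have "Poly_Mapping.keys (m + m') \<subseteq> ?A" by (rule keys_add)
  then show ?thesis
    by (simp add: mon_eval_superset[of ?A] lookup_add power_add prod.distrib)
qed

lemma mon_eval_single [simp]: "mon_eval a (Poly_Mapping.single v k) = a v ^ k"
  by (simp add: mon_eval_superset[of "{v}"])

lemma mon_eval_zero [simp]: "mon_eval a 0 = 1"
  by (simp add: mon_eval_def)

lemma mon_degree_superset:
  assumes "finite A" "Poly_Mapping.keys m \<subseteq> A"
  shows "mon_degree m = (\<Sum>v\<in>A. Poly_Mapping.lookup m v)"
  unfolding mon_degree_def using assms
  by (intro sum.mono_neutral_left) (auto simp: in_keys_iff)

lemma mon_degree_add: "mon_degree (m + m') = mon_degree m + mon_degree m'"
proof -
  let ?A = "Poly_Mapping.keys m \<union> Poly_Mapping.keys m'"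
  have "Poly_Mapping.keys (m + m') \<subseteq> ?A" by (rule keys_add)
  then show ?thesis
    by (simp add: mon_degree_superset[of ?A] lookup_add sum.distrib)
qed

lemma mon_degree_single [simp]: "mon_degree (Poly_Mapping.single v k) = k"
  by (simp add: mon_degree_superset[of "{v}"])

lemma poly_eval_superset:
  assumes "finite A" "Poly_Mapping.keys p \<subseteq> A"
  shows "poly_eval a p = (\<Sum>m\<in>A. Poly_Mapping.lookup p m * mon_eval a m)"
  unfolding poly_eval_def mon_eval_def[symmetric] using assms
  by (intro sum.mono_neutral_left) (auto simp: in_keys_iff)

lemma poly_eval_zero [simp]: "poly_eval a 0 = 0"
  by (simp add: poly_eval_def)

lemma poly_eval_single [simp]: "poly_eval a (Poly_Mapping.single m c) = c * mon_eval a m"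
  by (simp add: poly_eval_superset[of "{m}"])

lemma poly_eval_add [simp]: "poly_eval a (p + q) = poly_eval a p + poly_eval a q"
proof -
  let ?A = "Poly_Mapping.keys p \<union> Poly_Mapping.keys q"
  have "Poly_Mapping.keys (p + q) \<subseteq> ?A" by (rule keys_add)
  then show ?thesis
    by (simp add: poly_eval_superset[of ?A] lookup_add algebra_simps sum.distrib)
qed

lemma poly_eval_uminus [simp]: "poly_eval a (- p) = - poly_eval a p"
  using poly_eval_add[of a p "- p"] by simp

lemma poly_eval_diff [simp]: "poly_eval a (p - q) = poly_eval a p - poly_eval a q"
  using poly_eval_add[of a p "- q"] by simp

lemma poly_eval_sum: "poly_eval a (\<Sum>x\<in>A. p x) = (\<Sum>x\<in>A. poly_eval a (p x))"
  by (induction A rule: infinite_finite_induct) auto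

lemma sum_monomials: "p = (\<Sum>m\<in>Poly_Mapping.keys p. Poly_Mapping.single m (Poly_Mapping.lookup p m))"
proof (rule poly_mapping_eqI)
  fix m
  show "Poly_Mapping.lookup p m = Poly_Mapping.lookup
      (\<Sum>m\<in>Poly_Mapping.keys p. Poly_Mapping.single m (Poly_Mapping.lookup p m)) m"
    by (simp add: lookup_sum lookup_single when_def in_keys_iff)
qed

lemma poly_eval_mult [simp]: "poly_eval a (p * q) = poly_eval a p * poly_eval a q"
proof -
  have "poly_eval a (p * q) = poly_eval a
     (\<Sum>m\<in>Poly_Mapping.keys p. \<Sum>m'\<in>Poly_Mapping.keys q.
        Poly_Mapping.single (m + m') (Poly_Mapping.lookup p m * Poly_Mapping.lookup q m'))"
    by (subst sum_monomials[of p], subst sum_monomials[of q], unfold sum_product mult_single) (rule refl)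
  also have "\<dots> = poly_eval a p * poly_eval a q"
    by (simp add: poly_eval_sum poly_eval_superset[of "Poly_Mapping.keys p"]
        poly_eval_superset[of "Poly_Mapping.keys q"] sum_product mon_eval_add mult_ac)
  finally show ?thesis .
qed

lemma Const_0: "Const 0 = 0" and Const_1: "Const 1 = 1"
  by (simp_all add: Const_def)

lemma poly_eval_Const [simp]: "poly_eval a (Const c) = c"
  by (simp add: Const_def)

lemma poly_eval_Var [simp]: "poly_eval a (Var v) = a v"
  by (simp add: Var_def)

lemma poly_eval_one [simp]: "poly_eval a 1 = 1"
  using poly_eval_Const[of a 1] by (simp add: Const_1)

lemma poly_eval_power [simp]: "poly_eval a (p ^ k) = poly_eval a p ^ k"
  by (induction k) auto

lemma poly_eval_prod: "poly_eval a (\<Prod>x\<in>A. p x) = (\<Prod>x\<in>A. poly_eval a (p x))"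
  by (induction A rule: infinite_finite_induct) auto

lemma poly_eval_subst: "poly_eval a (poly_subst s p) = poly_eval (\<lambda>v. poly_eval a (s v)) p"
  by (simp add: poly_subst_def poly_eval_sum poly_eval_prod poly_eval_def[of _ p])

lemma poly_eval_cong:
  assumes "\<And>v. v \<in> vars p \<Longrightarrow> a v = b v"
  shows "poly_eval a p = poly_eval b p"
  unfolding poly_eval_def using assms
  by (intro sum.cong refl arg_cong2[where f = "(*)"] prod.cong arg_cong2[where f = "(^)"])
    (auto simp: vars_def)

lemma vars_Var [simp]: "vars (Var v) = {v}"
  by (simp add: vars_def Var_def)

lemma vars_Const [simp]: "vars (Const c) = {}"
  by (simp add: vars_def Const_def)

lemma vars_addI: "vars p \<subseteq> V \<Longrightarrow> vars q \<subseteq> V \<Longrightarrow> vars (p + q) \<subseteq> V"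
  using vars_add[of p q] by blast

lemma vars_multI: "vars p \<subseteq> V \<Longrightarrow> vars q \<subseteq> V \<Longrightarrow> vars (p * q) \<subseteq> V"
  using vars_mult[of p q] by blast

lemma vars_diffI: "vars p \<subseteq> V \<Longrightarrow> vars q \<subseteq> V \<Longrightarrow> vars (p - q) \<subseteq> V"
  using vars_addI[of p V "- q"] by simp

lemma vars_powerI: "vars p \<subseteq> V \<Longrightarrow> vars (p ^ k) \<subseteq> V"
  by (induction k) (simp_all add: vars_multI)

lemma vars_sumI: "(\<And>x. x \<in> A \<Longrightarrow> vars (p x) \<subseteq> V) \<Longrightarrow> vars (\<Sum>x\<in>A. p x) \<subseteq> V"
  by (induction A rule: infinite_finite_induct) (simp_all add: vars_addI)

lemma vars_prodI: "(\<And>x. x \<in> A \<Longrightarrow> vars (p x) \<subseteq> V) \<Longrightarrow> vars (\<Prod>x\<in>A. p x) \<subseteq> V"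
  by (induction A rule: infinite_finite_induct) (simp_all add: vars_multI)

lemma vars_substI:
  assumes "\<And>v. v \<in> vars p \<Longrightarrow> vars (s v) \<subseteq> V"
  shows "vars (poly_subst s p) \<subseteq> V"
  unfolding poly_subst_def using assms
  by (intro vars_sumI vars_multI vars_prodI vars_powerI) (auto simp: vars_def[of p])

lemma total_degree_le_iff:
  "total_degree p \<le> t \<longleftrightarrow> (\<forall>m\<in>Poly_Mapping.keys p. mon_degree m \<le> t)"
  by (simp add: total_degree_def)

lemma total_degree_add_le:
  "total_degree p \<le> t \<Longrightarrow> total_degree q \<le> t \<Longrightarrow> total_degree (p + q) \<le> t"
  using keys_add[of p q] by (auto simp: total_degree_le_iff)

lemma total_degree_diff_le:
  "total_degree p \<le> t \<Longrightarrow> total_degree q \<le> t \<Longrightarrow> total_degree (p - q) \<le> t"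
  using keys_diff[of p q] by (auto simp: total_degree_le_iff)

lemma total_degree_mult_le:
  assumes "total_degree p \<le> s" "total_degree q \<le> t"
  shows "total_degree (p * q) \<le> s + t"
  unfolding total_degree_le_iff
proof
  fix m assume "m \<in> Poly_Mapping.keys (p * q)"
  then obtain a b where "m = a + b" "a \<in> Poly_Mapping.keys p" "b \<in> Poly_Mapping.keys q"
    using keys_mult[of p q] by blast
  then show "mon_degree m \<le> s + t"
    using assms by (auto simp: total_degree_le_iff mon_degree_add intro: add_mono)
qed

lemma total_degree_Var [simp]: "total_degree (Var v) = 1"
  by (simp add: total_degree_def Var_def)

lemma total_degree_Const [simp]: "total_degree (Const c) = 0"
  by (simp add: total_degree_def Const_def mon_degree_def)

lemma total_degree_0 [simp]: "total_degree 0 = 0"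
  by (simp add: total_degree_def)

lemma total_degree_power_le: "total_degree p \<le> s \<Longrightarrow> total_degree (p ^ k) \<le> k * s"
proof (induction k)
  case 0
  then show ?case using total_degree_Const[of 1] by (simp add: Const_1)
next
  case (Suc k)
  then show ?case using total_degree_mult_le[of p s "p ^ k" "k * s"] by simp
qed

lemma total_degree_prod_le:
  assumes "\<And>x. x \<in> A \<Longrightarrow> total_degree (p x) \<le> d x"
  shows "total_degree (\<Prod>x\<in>A. p x) \<le> (\<Sum>x\<in>A. d x)"
  using assms
proof (induction A rule: infinite_finite_induct)
  case (insert x A)
  then show ?case by (simp add: total_degree_mult_le)
qed (use total_degree_Const[of 1] in \<open>auto simp: Const_1\<close>)

lemma total_degree_sum_le:
  "(\<And>x. x \<in> A \<Longrightarrow> total_degree (p x) \<le> t) \<Longrightarrow> total_degree (\<Sum>x\<in>A. p x) \<le> t"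
  by (induction A rule: infinite_finite_induct) (auto intro!: total_degree_add_le)

lemma total_degree_subst_le:
  assumes "\<And>v. total_degree (s v) \<le> 1" "total_degree p \<le> t"
  shows "total_degree (poly_subst s p) \<le> t"
  unfolding poly_subst_def
proof (rule total_degree_sum_le)
  fix m assume m: "m \<in> Poly_Mapping.keys p"
  have "total_degree (\<Prod>v\<in>Poly_Mapping.keys m. s v ^ Poly_Mapping.lookup m v) \<le> mon_degree m"
    unfolding mon_degree_def
    by (intro total_degree_prod_le) (use total_degree_power_le[OF assms(1)] in simp)
  also have "\<dots> \<le> t" using m assms(2) by (simp add: total_degree_le_iff)
  finally show "total_degree (Const (Poly_Mapping.lookup p m) *
      (\<Prod>v\<in>Poly_Mapping.keys m. s v ^ Poly_Mapping.lookup m v)) \<le> t"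
    using total_degree_mult_le[of "Const (Poly_Mapping.lookup p m)" 0] by simp
qed

lemma subst_Var [simp]: "poly_subst Var p = p"
proof -
  have mono: "mon_eval Var m = Poly_Mapping.single m 1" for m :: "'a \<Rightarrow>\<^sub>0 nat"
  proof -
    have pw: "Var v ^ k = Poly_Mapping.single (Poly_Mapping.single v k) (1::real)" for v :: 'a and k
      by (induction k) (simp_all add: Var_def mult_single single_add[symmetric])
    have pr: "(\<Prod>v\<in>A. Poly_Mapping.single (g v) (1::real)) = Poly_Mapping.single (\<Sum>v\<in>A. g v) 1"
      for A :: "'a set" and g :: "'a \<Rightarrow> 'a \<Rightarrow>\<^sub>0 nat"
      by (induction A rule: infinite_finite_induct) (simp_all add: mult_single)
    have "(\<Sum>v\<in>Poly_Mapping.keys m. Poly_Mapping.single v (Poly_Mapping.lookup m v)) = m"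
      by (rule poly_mapping_eqI) (simp add: lookup_sum lookup_single when_def in_keys_iff)
    then show ?thesis by (simp add: mon_eval_def pw pr)
  qed
  have "poly_subst Var p = (\<Sum>m\<in>Poly_Mapping.keys p. Poly_Mapping.single m (Poly_Mapping.lookup p m))"
    unfolding poly_subst_def mon_eval_def[symmetric] mono Const_def by (simp add: mult_single)
  then show ?thesis using sum_monomials[of p] by simp
qed

text \<open>Being generated by constants and variables inside \<open>R[V]\<close> is what reduces a congruence for all
  polynomials to a check on the variables. The identity substitution writes the polynomial as such an
  expression.\<close>

lemma poly_ring_induct [consumes 1, case_names Const Var add mult]:
  assumes "vars p \<subseteq> V"
    and const: "\<And>c. P (Const c)"
    and var: "\<And>v. v \<in> V \<Longrightarrow> P (Var v)"
    and add: "\<And>p q. vars p \<subseteq> V \<Longrightarrow> vars q \<subseteq> V \<Longrightarrow> P p \<Longrightarrow> P q \<Longrightarrow> P (p + q)"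
    and mult: "\<And>p q. vars p \<subseteq> V \<Longrightarrow> vars q \<subseteq> V \<Longrightarrow> P p \<Longrightarrow> P q \<Longrightarrow> P (p * q)"
  shows "P p"
proof -
  let ?Q = "\<lambda>p. vars p \<subseteq> V \<and> P p"
  have Q01: "?Q 0" "?Q 1" using const[of 0] const[of 1] by (auto simp: Const_0 Const_1)
  have Qpow: "?Q (q ^ k)" if "?Q q" for q k
    using that Q01 by (induction k) (simp_all add: mult vars_multI)
  have Qprod: "?Q (\<Prod>x\<in>A. q x)" if "\<And>x. x \<in> A \<Longrightarrow> ?Q (q x)" for A :: "'a set" and q
    using that Q01
    by (induction A rule: infinite_finite_induct) (simp_all add: mult vars_multI)
  have Qsum: "?Q (\<Sum>x\<in>A. q x)" if "\<And>x. x \<in> A \<Longrightarrow> ?Q (q x)" for A :: "('a \<Rightarrow>\<^sub>0 nat) set" and q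
    using that Q01
    by (induction A rule: infinite_finite_induct) (simp_all add: add vars_addI)
  have "?Q (poly_subst Var p)"
    unfolding poly_subst_def
  proof (rule Qsum)
    fix m assume m: "m \<in> Poly_Mapping.keys p"
    have "?Q (\<Prod>v\<in>Poly_Mapping.keys m. Var v ^ Poly_Mapping.lookup m v)"
      using m assms(1) by (intro Qprod Qpow) (auto simp: vars_def[of p] intro: var)
    then show "?Q (Const (Poly_Mapping.lookup p m) *
        (\<Prod>v\<in>Poly_Mapping.keys m. Var v ^ Poly_Mapping.lookup m v))"
      using const by (simp add: mult vars_multI)
  qed
  then show ?thesis by simp
qed


section \<open>Ideals that contain the Boolean relations\<close>

lemma poly_ring_simps [simp]:
  "p \<in> carrier (poly_ring V) \<longleftrightarrow> vars p \<subseteq> V"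
  "p \<oplus>\<^bsub>poly_ring V\<^esub> q = p + q" "p \<otimes>\<^bsub>poly_ring V\<^esub> q = p * q"
  "\<zero>\<^bsub>poly_ring V\<^esub> = 0" "\<one>\<^bsub>poly_ring V\<^esub> = 1"
  by (simp_all add: poly_ring_def)

lemma ideal_vanishing:
  "ideal {p. vars p \<subseteq> V \<and> (\<forall>a\<in>Z. poly_eval a p = 0)} (poly_ring V)" (is "ideal ?I _")
proof -
  interpret R: cring "poly_ring V" by (rule cring_poly_ring)
  have neg: "\<ominus>\<^bsub>poly_ring V\<^esub> p = - p" if "vars p \<subseteq> V" for p
    using that by (intro R.minus_equality) simp_all
  show ?thesis
  proof (rule idealI)
    show "subgroup ?I (add_monoid (poly_ring V))"
    proof (rule R.add.subgroupI)
      show "?I \<noteq> {}" by (auto intro!: exI[of _ 0])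
    qed (use neg in \<open>auto simp: vars_addI\<close>)
  qed (auto simp: R.ring_axioms vars_multI)
qed

text \<open>The Lagrange basis polynomial of the vertex \<open>1\<^sub>S\<close> of the cube \<open>{0,1}\<^sup>V\<close>: it is \<open>1\<close> at that
  vertex and \<open>0\<close> at all others.\<close>

definition indicator_poly :: "'v set \<Rightarrow> 'v set \<Rightarrow> 'v rpoly" where
  "indicator_poly V S = (\<Prod>v\<in>S. Var v) * (\<Prod>v\<in>V - S. 1 - Var v)"

lemma vars_indicator_poly: "S \<subseteq> V \<Longrightarrow> vars (indicator_poly V S) \<subseteq> V"
  unfolding indicator_poly_def by (intro vars_multI vars_prodI vars_diffI) auto

text \<open>Expand the product of the factors \<open>v + (1 - v) = 1\<close>. The identity is one of polynomials, not
  merely of values on the cube.\<close>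

lemma sum_indicator_poly: "finite V \<Longrightarrow> (\<Sum>S\<in>Pow V. indicator_poly V S) = 1"
  using prod_add[of V Var "\<lambda>v. 1 - Var v"] by (simp add: indicator_poly_def)

text \<open>Split \<open>p\<close> into its products with the Lagrange polynomials \<open>\<delta>\<^sub>S\<close>. Modulo the relations
  \<open>v\<^sup>2 - v\<close>, multiplying \<open>\<delta>\<^sub>S\<close> by any \<open>q\<close> has the same effect as scaling it by the number \<open>q(1\<^sub>S)\<close>. So
  \<open>p \<delta>\<^sub>S\<close> is in \<open>I\<close> if \<open>p(1\<^sub>S) = 0\<close>; and otherwise some \<open>g \<in> I\<close> has \<open>g(1\<^sub>S) \<noteq> 0\<close>, which puts \<open>\<delta>\<^sub>S\<close> itself
  into \<open>I\<close>.\<close>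

lemma boolean_ideal_mem:
  assumes fin: "finite V" and I: "ideal I (poly_ring V)"
    and bool: "\<And>v. v \<in> V \<Longrightarrow> (Var v)\<^sup>2 - Var v \<in> I"
    and p: "vars p \<subseteq> V"
    and van: "\<And>S. S \<subseteq> V \<Longrightarrow> (\<And>g. g \<in> I \<Longrightarrow> poly_eval (indicator S) g = 0) \<Longrightarrow>
                poly_eval (indicator S) p = 0"
  shows "p \<in> I"
proof -
  interpret ideal I "poly_ring V" by (rule I)
  have I0: "0 \<in> I" and Iadd: "\<And>g h. g \<in> I \<Longrightarrow> h \<in> I \<Longrightarrow> g + h \<in> I"
    and Imult: "\<And>g h. g \<in> I \<Longrightarrow> vars h \<subseteq> V \<Longrightarrow> h * g \<in> I"
    using additive_subgroup.zero_closed[OF is_additive_subgroup]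
      additive_subgroup.a_closed[OF is_additive_subgroup] I_l_closed by simp_all
  have Idiff: "g - h \<in> I" if "g \<in> I" "h \<in> I" for g h
    using Iadd[OF that(1) Imult[OF that(2), of "- 1"]] by simp
  have IV: "vars g \<subseteq> V" if "g \<in> I" for g
    using a_Hcarr[OF that] by simp
  have Isum: "(\<Sum>x\<in>A. g x) \<in> I" if "\<And>x. x \<in> A \<Longrightarrow> g x \<in> I" for A :: "'a set set" and g
    using that by (induction A rule: infinite_finite_induct) (simp_all add: I0 Iadd)
  have red: "(q - Const (poly_eval (indicator S) q)) * indicator_poly V S \<in> I"
    if "vars q \<subseteq> V" and S: "S \<subseteq> V" for q S
    using that(1)
  proof (induction rule: poly_ring_induct)
    case (Const c)
    then show ?case by (simp add: I0)
  next
    case (Var v)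
    let ?P = "\<Prod>w\<in>S. Var w" and ?Q = "\<Prod>w\<in>V - S. 1 - Var w"
    have finS: "finite S" using S fin by (rule finite_subset)
    show ?case
    proof (cases "v \<in> S")
      case True
      have "(Var v - 1) * indicator_poly V S = (\<Prod>w\<in>S - {v}. Var w) * ?Q * ((Var v)\<^sup>2 - Var v)"
        using True finS by (simp add: indicator_poly_def prod.remove[of S v] algebra_simps power2_eq_square)
      moreover have "\<dots> \<in> I"
        using S Var by (intro Imult bool vars_multI vars_prodI vars_diffI) auto
      ultimately show ?thesis using True by (simp add: Const_1)
    next
      case False
      have "Var v * indicator_poly V S = (?P * (\<Prod>w\<in>V - S - {v}. 1 - Var w) * (- 1)) * ((Var v)\<^sup>2 - Var v)"
        using False fin Var
        by (simp add: indicator_poly_def prod.remove[of "V - S" v] algebra_simps power2_eq_square)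
      moreover have "\<dots> \<in> I"
        using S Var by (intro Imult bool vars_multI vars_prodI vars_diffI) auto
      ultimately show ?thesis using False by (simp add: Const_0)
    qed
  next
    case (add p q)
    then show ?case
      using Iadd[OF add.IH] by (simp add: Const_def single_add algebra_simps)
  next
    case (mult p q)
    let ?c = "Const (poly_eval (indicator S) p) :: 'a rpoly"
      and ?d = "Const (poly_eval (indicator S) q) :: 'a rpoly"
    let ?D = "indicator_poly V S"
    have "q * ((p - ?c) * ?D) + ?c * ((q - ?d) * ?D) \<in> I"
      using mult.hyps by (intro Iadd[OF Imult[OF mult.IH(1)] Imult[OF mult.IH(2)]]) simp_all
    moreover have "Const (poly_eval (indicator S) (p * q)) = ?c * ?d"
      by (simp add: Const_def mult_single)
    moreover have "q * ((p - ?c) * ?D) + ?c * ((q - ?d) * ?D) = (p * q - ?c * ?d) * ?D"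
      by (simp add: algebra_simps)
    ultimately show ?case by (simp only:)
  qed
  (* A vertex where p does not vanish is no common zero of I, so its Lagrange polynomial is in I. *)
  have "p * indicator_poly V S \<in> I" if S: "S \<subseteq> V" for S
  proof (cases "\<forall>g\<in>I. poly_eval (indicator S) g = 0")
    case True
    then have "poly_eval (indicator S) p = 0" using van[OF S] by blast
    then show ?thesis using red[OF p S] by (simp add: Const_0)
  next
    case False
    then obtain g where g: "g \<in> I" and g0: "poly_eval (indicator S) g \<noteq> 0" by blast
    let ?c = "poly_eval (indicator S) g"
    have "indicator_poly V S * g - (g - Const ?c) * indicator_poly V S \<in> I"
      using g S by (intro Idiff Imult red IV vars_indicator_poly)
    then have "Const ?c * indicator_poly V S \<in> I" by (simp add: algebra_simps)
    then have "(p * Const (1 / ?c)) * (Const ?c * indicator_poly V S) \<in> I"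
      by (rule Imult) (simp add: p vars_multI)
    moreover have "Const (1 / ?c) * Const ?c = (1 :: 'a rpoly)"
      using g0 by (simp add: Const_def mult_single)
    then have "p * (Const (1 / ?c) * Const ?c) * indicator_poly V S = p * indicator_poly V S"
      by simp
    then have "(p * Const (1 / ?c)) * (Const ?c * indicator_poly V S) = p * indicator_poly V S"
      by (simp only: mult.assoc)
    ultimately show ?thesis by simp
  qed
  then have "(\<Sum>S\<in>Pow V. p * indicator_poly V S) \<in> I" by (intro Isum) auto
  then show ?thesis by (simp add: sum_distrib_left[symmetric] sum_indicator_poly[OF fin])
qed

text \<open>A Nullstellensatz over the reals for ideals that contain the Boolean relations: these
  relations make the ideal radical with only real zeros.\<close>

lemma mem_genideal_iff_vanishing:
  assumes fin: "finite V" and B: "\<And>b. b \<in> B \<Longrightarrow> vars b \<subseteq> V"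
    and bool: "\<And>v. v \<in> V \<Longrightarrow> (Var v)\<^sup>2 - Var v \<in> B"
  shows "p \<in> genideal (poly_ring V) B \<longleftrightarrow>
    vars p \<subseteq> V \<and> (\<forall>a. (\<forall>b\<in>B. poly_eval a b = 0) \<longrightarrow> poly_eval a p = 0)"
    (is "p \<in> ?I \<longleftrightarrow> _")
proof -
  interpret R: cring "poly_ring V" by (rule cring_poly_ring)
  have carr: "B \<subseteq> carrier (poly_ring V)" using B by auto
  note I = R.genideal_ideal[OF carr] and BI = R.genideal_self[OF carr]
  show ?thesis
  proof (intro iffI conjI; (elim conjE)?)
    assume "p \<in> ?I"
    then have "p \<in> {p. vars p \<subseteq> V \<and> (\<forall>a\<in>{a. \<forall>b\<in>B. poly_eval a b = 0}. poly_eval a p = 0)}"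
      by (rule R.genideal_minimal[OF ideal_vanishing, THEN subsetD, rotated]) (use B in auto)
    then show "vars p \<subseteq> V" "\<forall>a. (\<forall>b\<in>B. poly_eval a b = 0) \<longrightarrow> poly_eval a p = 0"
      by auto
  next
    assume p: "vars p \<subseteq> V" and van: "\<forall>a. (\<forall>b\<in>B. poly_eval a b = 0) \<longrightarrow> poly_eval a p = 0"
    show "p \<in> ?I"
    proof (rule boolean_ideal_mem[OF fin I _ p])
      show "(Var v)\<^sup>2 - Var v \<in> ?I" if "v \<in> V" for v
        using BI bool[OF that] by (rule subsetD)
      show "poly_eval (indicator S) p = 0" if "\<And>g. g \<in> ?I \<Longrightarrow> poly_eval (indicator S) g = 0" for S
        using van that subsetD[OF BI] by simp
    qed
  qed
qed

text \<open>A list of squares, in place of a family indexed by \<open>{1..m}\<close>, makes it easy to join the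
  certificates of several polynomials.\<close>

lemma sos_mod_genideal_iff:
  assumes fin: "finite V" and B: "\<And>b. b \<in> B \<Longrightarrow> vars b \<subseteq> V"
    and bool: "\<And>v. v \<in> V \<Longrightarrow> (Var v)\<^sup>2 - Var v \<in> B"
  shows "sos_mod V t (genideal (poly_ring V) B) p \<longleftrightarrow> vars p \<subseteq> V \<and>
    (\<exists>qs. (\<forall>q\<in>set qs. vars q \<subseteq> V \<and> total_degree q \<le> t) \<and>
      (\<forall>a. (\<forall>b\<in>B. poly_eval a b = 0) \<longrightarrow> poly_eval a p = (\<Sum>q\<leftarrow>qs. (poly_eval a q)\<^sup>2)))"
    (is "_ \<longleftrightarrow> _ \<and> ?R")
proof -
  have list: "sum_list (map g (map q [1..<Suc m])) = (\<Sum>r=1..m. g (q r))"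
    for g :: "'a rpoly \<Rightarrow> real" and q m
    by (simp only: map_map o_def interv_sum_list_conv_sum_set_nat set_upt atLeastLessThanSuc_atLeastAtMost)
  have mem: "g \<in> genideal (poly_ring V) B \<longleftrightarrow>
      vars g \<subseteq> V \<and> (\<forall>a. (\<forall>b\<in>B. poly_eval a b = 0) \<longrightarrow> poly_eval a g = 0)" for g
    by (rule mem_genideal_iff_vanishing[OF fin]) (fact B, fact bool)
  show ?thesis
  proof (intro iffI)
    assume "sos_mod V t (genideal (poly_ring V) B) p"
    then obtain m :: nat and q where q: "\<And>r. r \<in> {1..m} \<Longrightarrow> vars (q r) \<subseteq> V \<and> total_degree (q r) \<le> t"
      and "p - (\<Sum>r=1..m. (q r)\<^sup>2) \<in> genideal (poly_ring V) B"
      unfolding sos_mod_def poly_ring_simps by blast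
    then have V: "vars (p - (\<Sum>r=1..m. (q r)\<^sup>2)) \<subseteq> V"
      and ev: "\<And>a. \<forall>b\<in>B. poly_eval a b = 0 \<Longrightarrow> poly_eval a p = (\<Sum>r=1..m. (poly_eval a (q r))\<^sup>2)"
      unfolding mem by (simp_all add: poly_eval_sum)
    have "vars ((p - (\<Sum>r=1..m. (q r)\<^sup>2)) + (\<Sum>r=1..m. (q r)\<^sup>2)) \<subseteq> V"
      using V q by (intro vars_addI vars_sumI vars_powerI) auto
    moreover have ?R
    proof (intro exI conjI ballI allI impI)
      fix r assume "r \<in> set (map q [1..<Suc m])"
      then obtain k where "k \<in> {1..m}" "r = q k" by (auto simp del: upt_Suc simp: less_Suc_eq_le)
      then show "vars r \<subseteq> V" "total_degree r \<le> t" using q by blast+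
    next
      fix a assume "\<forall>b\<in>B. poly_eval a b = 0"
      then show "poly_eval a p = (\<Sum>q\<leftarrow>map q [1..<Suc m]. (poly_eval a q)\<^sup>2)"
        unfolding list by (rule ev)
    qed
    ultimately show "vars p \<subseteq> V \<and> ?R" by simp
  next
    assume "vars p \<subseteq> V \<and> ?R"
    then obtain qs where p: "vars p \<subseteq> V" and qs: "\<And>q. q \<in> set qs \<Longrightarrow> vars q \<subseteq> V \<and> total_degree q \<le> t"
      and ev: "\<And>a. \<forall>b\<in>B. poly_eval a b = 0 \<Longrightarrow> poly_eval a p = (\<Sum>q\<leftarrow>qs. (poly_eval a q)\<^sup>2)"
      by blast
    define q where "q r = qs ! (r - 1)" for r
    have q: "vars (q r) \<subseteq> V \<and> total_degree (q r) \<le> t" if "r \<in> {1..length qs}" for r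
      using that qs[of "q r"] by (auto simp: q_def)
    have "qs = map q [1..<Suc (length qs)]"
      by (rule nth_equalityI) (auto simp: q_def simp del: upt_Suc)
    then have "poly_eval a p = (\<Sum>r=1..length qs. (poly_eval a (q r))\<^sup>2)"
      if "\<forall>b\<in>B. poly_eval a b = 0" for a
      using ev[OF that] list[of "\<lambda>q. (poly_eval a q)\<^sup>2" q "length qs"] by metis
    then have "p - (\<Sum>r=1..length qs. (q r)\<^sup>2) \<in> genideal (poly_ring V) B"
      unfolding mem using p q
      by (intro conjI vars_diffI vars_sumI vars_powerI) (auto simp: poly_eval_sum)
    then show "sos_mod V t (genideal (poly_ring V) B) p"
      unfolding sos_mod_def poly_ring_simps using q by blast
  qed
qed

lemma sos_mod_I2_iff:
  "sos_mod (vars2 n i j) t (I2 n i j) p \<longleftrightarrow> vars p \<subseteq> vars2 n i j \<and>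
    (\<exists>qs. (\<forall>q\<in>set qs. vars q \<subseteq> vars2 n i j \<and> total_degree q \<le> t) \<and>
      (\<forall>a. (\<forall>k\<in>vars2 n i j. (a k)\<^sup>2 = a k) \<longrightarrow> poly_eval a p = (\<Sum>q\<leftarrow>qs. (poly_eval a q)\<^sup>2)))"
  unfolding I2_def
proof (subst sos_mod_genideal_iff)
  fix b :: "nat rpoly" assume "b \<in> (\<lambda>k. (Var k)\<^sup>2 - Var k) ` vars2 n i j"
  then obtain k where "k \<in> vars2 n i j" "b = (Var k)\<^sup>2 - Var k" by blast
  then show "vars b \<subseteq> vars2 n i j" by (simp add: vars_diffI vars_powerI)
qed (auto simp: vars2_def)

text \<open>The zeros of the generators of \<open>I1\<close>: the equations force each pair \<open>(x\<^sub>k, y\<^sub>k)\<close> to be one of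
  \<open>(0,0)\<close>, \<open>(0,1)\<close> and \<open>(1,1)\<close>.\<close>

definition ordered_boolean :: "nat set \<Rightarrow> (xy \<Rightarrow> real) \<Rightarrow> bool" where
  "ordered_boolean K a \<longleftrightarrow>
    (\<forall>k\<in>K. (a (X k))\<^sup>2 = a (X k) \<and> a (X k) * a (Y k) = a (X k) \<and> (a (Y k))\<^sup>2 = a (Y k))"

lemma sos_mod_I1_iff:
  "sos_mod (vars1 n i) t (I1 n i) p \<longleftrightarrow> vars p \<subseteq> vars1 n i \<and>
    (\<exists>qs. (\<forall>q\<in>set qs. vars q \<subseteq> vars1 n i \<and> total_degree q \<le> t) \<and>
      (\<forall>a. ordered_boolean ({1..n} - {i}) a \<longrightarrow>
        poly_eval a p = (\<Sum>q\<leftarrow>qs. (poly_eval a q)\<^sup>2)))"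
proof -
  let ?B = "\<Union>k\<in>{1..n} - {i}. {(Var (X k))\<^sup>2 - Var (X k),
    Var (X k) * Var (Y k) - Var (X k), (Var (Y k))\<^sup>2 - Var (Y k)}"
  have B: "vars b \<subseteq> vars1 n i" if b: "b \<in> ?B" for b
  proof -
    obtain k where "k \<in> {1..n} - {i}" and b: "b = (Var (X k))\<^sup>2 - Var (X k) \<or>
        b = Var (X k) * Var (Y k) - Var (X k) \<or> b = (Var (Y k))\<^sup>2 - Var (Y k)"
      using b by blast
    then have "X k \<in> vars1 n i" "Y k \<in> vars1 n i" by (auto simp: vars1_def)
    then show ?thesis using b by (elim disjE) (simp_all add: vars_diffI vars_multI vars_powerI)
  qed
  have fin: "finite (vars1 n i)" by (simp add: vars1_def)
  have bool: "(Var v)\<^sup>2 - Var v \<in> ?B" if "v \<in> vars1 n i" for v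
    using that unfolding vars1_def by blast
  have "(\<forall>b\<in>?B. poly_eval a b = 0) \<longleftrightarrow> ordered_boolean ({1..n} - {i}) a" for a
    by (simp add: ordered_boolean_def)
  then show ?thesis
    unfolding I1_def by (subst sos_mod_genideal_iff[OF fin B bool]) simp_all
qed

section \<open>Differences along a coordinate\<close>

text \<open>The value at \<open>v = 1\<close> minus the value at \<open>v = 0\<close>, as a polynomial in the other variables. Only the
  monomials that contain \<open>v\<close> contribute, and they lose their power of \<open>v\<close>. This is the partial
  derivative of a multilinear polynomial, but unlike the derivative it has the meaning of a difference
  for every polynomial, in particular for the polynomials that are squared.\<close>

definition unit_difference :: "'v \<Rightarrow> 'v rpoly \<Rightarrow> 'v rpoly" where
  "unit_difference v p = (\<Sum>m\<in>{m\<in>Poly_Mapping.keys p. v \<in> Poly_Mapping.keys m}.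
     Poly_Mapping.single (Poly_Mapping.update v 0 m) (Poly_Mapping.lookup p m))"

lemma monomial_split:
  "m = Poly_Mapping.update v 0 m + Poly_Mapping.single v (Poly_Mapping.lookup m v)"
  by (rule poly_mapping_eqI) (simp add: lookup_add lookup_update lookup_single when_def)

lemma mon_eval_fun_upd:
  fixes c :: "'a::comm_monoid_mult"
  shows "mon_eval (a(v := c)) m = mon_eval a (Poly_Mapping.update v 0 m) * c ^ Poly_Mapping.lookup m v"
proof -
  have "mon_eval (a(v := c)) (Poly_Mapping.update v 0 m) = mon_eval a (Poly_Mapping.update v 0 m)"
    unfolding mon_eval_def by (intro prod.cong) (auto simp: keys_update)
  then show ?thesis
    by (subst monomial_split[of m v]) (simp add: mon_eval_add)
qed

lemma keys_unit_difference:
  assumes "m \<in> Poly_Mapping.keys (unit_difference v p)"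
  obtains m' where "m' \<in> Poly_Mapping.keys p" "v \<in> Poly_Mapping.keys m'"
    "m = Poly_Mapping.update v 0 m'"
  using assms keys_sum[of "\<lambda>m. Poly_Mapping.single (Poly_Mapping.update v 0 m) (Poly_Mapping.lookup p m)"
      "{m\<in>Poly_Mapping.keys p. v \<in> Poly_Mapping.keys m}"]
  by (fastforce simp: unit_difference_def split: if_splits)

lemma vars_unit_difference: "vars (unit_difference v p) \<subseteq> vars p - {v}"
  by (auto simp: vars_def keys_update elim!: keys_unit_difference)

lemma multilinear_unit_difference: "multilinear p \<Longrightarrow> multilinear (unit_difference v p)"
  by (auto simp: multilinear_def lookup_update elim!: keys_unit_difference)

text \<open>Every monomial that contributes contains \<open>v\<close> and loses it.\<close>

lemma total_degree_unit_difference: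
  assumes "total_degree p \<le> t + 1"
  shows "total_degree (unit_difference v p) \<le> t"
  unfolding total_degree_le_iff
proof
  fix m assume "m \<in> Poly_Mapping.keys (unit_difference v p)"
  then obtain m' where m': "m' \<in> Poly_Mapping.keys p" "v \<in> Poly_Mapping.keys m'"
    "m = Poly_Mapping.update v 0 m'" by (rule keys_unit_difference)
  have "mon_degree m' = mon_degree m + Poly_Mapping.lookup m' v"
    unfolding m'(3) by (subst monomial_split[of m' v]) (simp only: mon_degree_add mon_degree_single)
  moreover have "mon_degree m' \<le> t + 1" using assms m'(1) by (simp add: total_degree_le_iff)
  moreover have "Poly_Mapping.lookup m' v \<noteq> 0" using m'(2) by (simp add: in_keys_iff)
  ultimately show "mon_degree m \<le> t" by linarith
qed

lemma poly_eval_keys: "poly_eval a p = (\<Sum>m\<in>Poly_Mapping.keys p. Poly_Mapping.lookup p m * mon_eval a m)"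
  by (rule poly_eval_superset) auto

lemma poly_eval_unit_difference_keys:
  "poly_eval a (unit_difference v p) = (\<Sum>m\<in>Poly_Mapping.keys p.
     if v \<in> Poly_Mapping.keys m then Poly_Mapping.lookup p m * mon_eval a (Poly_Mapping.update v 0 m) else 0)"
  unfolding unit_difference_def poly_eval_sum poly_eval_single by (rule sum.inter_filter) simp

lemma poly_eval_unit_difference:
  "poly_eval a (unit_difference v p) = poly_eval (a(v := 1)) p - poly_eval (a(v := 0)) p"
  unfolding poly_eval_unit_difference_keys unfolding poly_eval_keys sum_subtractf[symmetric]
  by (intro sum.cong refl) (simp add: mon_eval_fun_upd in_keys_iff)

text \<open>A multilinear polynomial is affine in \<open>v\<close>, with the unit difference as its slope.\<close>

lemma poly_eval_fun_upd_diff_multilinear: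
  assumes "multilinear p"
  shows "poly_eval (a(v := c)) p - poly_eval (a(v := d)) p = (c - d) * poly_eval a (unit_difference v p)"
  unfolding poly_eval_unit_difference_keys unfolding poly_eval_keys sum_subtractf[symmetric] sum_distrib_left
proof (intro sum.cong refl)
  fix m assume "m \<in> Poly_Mapping.keys p"
  then have "Poly_Mapping.lookup m v = 0 \<or> Poly_Mapping.lookup m v = 1"
    using assms by (auto simp: multilinear_def le_Suc_eq)
  then show "Poly_Mapping.lookup p m * mon_eval (a(v := c)) m - Poly_Mapping.lookup p m * mon_eval (a(v := d)) m =
      (c - d) * (if v \<in> Poly_Mapping.keys m then Poly_Mapping.lookup p m * mon_eval a (Poly_Mapping.update v 0 m) else 0)"
    by (auto simp: mon_eval_fun_upd in_keys_iff algebra_simps)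
qed

lemma partial_deriv_multilinear:
  assumes "multilinear p"
  shows "partial_deriv v p = unit_difference v p"
  unfolding partial_deriv_def unit_difference_def
proof (rule sum.mono_neutral_cong_right)
  fix m assume m: "m \<in> {m \<in> Poly_Mapping.keys p. v \<in> Poly_Mapping.keys m}"
  then have "Poly_Mapping.lookup m v \<le> 1" "Poly_Mapping.lookup m v \<noteq> 0"
    using assms by (auto simp: multilinear_def in_keys_iff)
  then have 1: "Poly_Mapping.lookup m v = 1" by linarith
  then have "m - Poly_Mapping.single v 1 = Poly_Mapping.update v 0 m"
    by (intro poly_mapping_eqI) (auto simp: lookup_minus lookup_update lookup_single when_def)
  then show "Poly_Mapping.single (m - Poly_Mapping.single v 1)
      (real (Poly_Mapping.lookup m v) * Poly_Mapping.lookup p m) =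
      Poly_Mapping.single (Poly_Mapping.update v 0 m) (Poly_Mapping.lookup p m)"
    using 1 by simp
qed (auto simp: in_keys_iff intro: ccontr)


section \<open>Certificates of antitonicity and certificates along the coordinates\<close>

text \<open>The path from \<open>a\<close> to \<open>b\<close> changes the coordinates \<open>1, \<dots>, n\<close> in this order.\<close>

lemma poly_eval_telescope:
  fixes a b :: "nat \<Rightarrow> real"
  assumes "multilinear p" "vars p \<subseteq> {1..n}"
  shows "poly_eval a p - poly_eval b p =
    (\<Sum>j=1..n. (a j - b j) * poly_eval (\<lambda>k. if k < j then b k else a k) (unit_difference j p))"
proof -
  define z where "z j = (\<lambda>k. if k < j then b k else a k)" for j :: nat
  have step: "poly_eval (z j) p - poly_eval (z (Suc j)) p =
      (a j - b j) * poly_eval (z j) (unit_difference j p)" for j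
  proof -
    have "z j = (z j)(j := a j)" "z (Suc j) = (z j)(j := b j)"
      by (auto simp: z_def fun_eq_iff)
    then show ?thesis using poly_eval_fun_upd_diff_multilinear[OF assms(1)] by metis
  qed
  have "(\<Sum>j=1..n. (a j - b j) * poly_eval (z j) (unit_difference j p)) =
      (\<Sum>j=1..n. poly_eval (z j) p - poly_eval (z (Suc j)) p)"
    by (simp add: step)
  also have "\<dots> = poly_eval (z 1) p - poly_eval (z (Suc n)) p"
    using sum_Suc_diff[of 1 n "\<lambda>j. - poly_eval (z j) p"] by simp
  also have "poly_eval (z 1) p = poly_eval a p"
    using assms(2) by (intro poly_eval_cong) (auto simp: z_def)
  also have "poly_eval (z (Suc n)) p = poly_eval b p"
    using assms(2) by (intro poly_eval_cong) (auto simp: z_def)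
  finally show ?thesis by (simp add: z_def)
qed

text \<open>Restricting the squares to \<open>x = y\<close> outside \<open>j\<close> and \<open>(x\<^sub>j, y\<^sub>j) = (0, 1)\<close> gives squares of degree
  \<open>t + 1\<close>. They can be replaced by unit differences in \<open>y\<^sub>j\<close>, of degree \<open>t\<close>, since a sum of real squares
  that is zero on the diagonal \<open>x = y\<close> has all its terms zero there.\<close>

lemma sos_antitone_imp_sos_differences:
  assumes G: "multilinear G" "vars G \<subseteq> {1..n} - {i}" and j: "j \<in> {1..n} - {i}"
    and sos: "sos_mod (vars1 n i) (t + 1) (I1 n i)
      (poly_subst (\<lambda>k. Var (X k)) G - poly_subst (\<lambda>k. Var (Y k)) G)"
  shows "sos_mod (vars2 n j i) t (I2 n j i) (- unit_difference j G)"
proof -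
  obtain qs where qs: "\<And>q. q \<in> set qs \<Longrightarrow> vars q \<subseteq> vars1 n i \<and> total_degree q \<le> t + 1"
    and ev: "\<And>a. ordered_boolean ({1..n} - {i}) a \<Longrightarrow>
      poly_eval (\<lambda>k. a (X k)) G - poly_eval (\<lambda>k. a (Y k)) G = (\<Sum>q\<leftarrow>qs. (poly_eval a q)\<^sup>2)"
    using sos unfolding sos_mod_I1_iff poly_eval_diff poly_eval_subst poly_eval_Var by blast
  (* The unit difference in Y j has no Y j left, so s (Y j) = 0 is just a default value. *)
  define s :: "xy \<Rightarrow> nat rpoly" where
    "s v = (case v of X k \<Rightarrow> if k = j then 0 else Var k | Y k \<Rightarrow> if k = j then 0 else Var k)" for v
  define r where "r q = poly_subst s (unit_difference (Y j) q)" for q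
  show ?thesis
    unfolding sos_mod_I2_iff
  proof (intro conjI exI ballI allI impI)
    show "vars (- unit_difference j G) \<subseteq> vars2 n j i"
      using vars_unit_difference[of j G] G(2) by (auto simp: vars2_def)
  next
    fix p assume "p \<in> set (map r qs)"
    then obtain q where q: "q \<in> set qs" and p: "p = r q" by auto
    have "vars (unit_difference (Y j) q) \<subseteq> vars1 n i"
      using vars_unit_difference[of "Y j" q] qs[OF q] by blast
    moreover have "vars (s v) \<subseteq> vars2 n j i" if "v \<in> vars1 n i" for v
      using that by (auto simp: s_def vars1_def vars2_def split: if_splits)
    ultimately show "vars p \<subseteq> vars2 n j i"
      unfolding p r_def by (intro vars_substI) blast
    show "total_degree p \<le> t"
      unfolding p r_def using qs[OF q]
      by (intro total_degree_subst_le total_degree_unit_difference) (auto simp: s_def split: xy.split)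
  next
    fix a :: "nat \<Rightarrow> real" assume a: "\<forall>k\<in>vars2 n j i. (a k)\<^sup>2 = a k"
    (* c 0 is a point of the diagonal x = y; c 1 differs from it only by y_j = 1. *)
    define c where "c y v = (case v of X k \<Rightarrow> (a(j := 0)) k | Y k \<Rightarrow> (a(j := y)) k)" for y :: real and v
    have bool: "ordered_boolean ({1..n} - {i}) (c y)" if "y = 0 \<or> y = 1" for y
      unfolding ordered_boolean_def
    proof
      fix k assume "k \<in> {1..n} - {i}"
      then have "k \<noteq> j \<Longrightarrow> (a k)\<^sup>2 = a k" using a by (simp add: vars2_def)
      then show "(c y (X k))\<^sup>2 = c y (X k) \<and> c y (X k) * c y (Y k) = c y (X k) \<and>
          (c y (Y k))\<^sup>2 = c y (Y k)"
        using that by (cases "k = j") (auto simp: c_def power2_eq_square)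
    qed
    have cX: "(\<lambda>k. c y (X k)) = a(j := 0)" and cY: "(\<lambda>k. c y (Y k)) = a(j := y)" for y
      by (auto simp: c_def)
    have "(\<Sum>q\<leftarrow>qs. (poly_eval (c 0) q)\<^sup>2) = 0"
      using ev[OF bool, of 0] by (simp add: cX cY)
    then have "\<forall>x\<in>set (map (\<lambda>q. (poly_eval (c 0) q)\<^sup>2) qs). x = 0"
      by (subst (asm) sum_list_nonneg_eq_0_iff) auto
    then have diag: "poly_eval (c 0) q = 0" if "q \<in> set qs" for q
      using that by simp
    have r: "poly_eval a (r q) = poly_eval (c 1) q" if "q \<in> set qs" for q
    proof -
      have "(\<lambda>v. poly_eval a (s v)) = c 0"
        by (auto simp: s_def c_def fun_eq_iff split: xy.split)
      moreover have "(c 0)(Y j := 1) = c 1" "(c 0)(Y j := 0) = c 0"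
        by (auto simp: c_def fun_eq_iff split: xy.split)
      ultimately show ?thesis
        by (simp add: r_def poly_eval_subst poly_eval_unit_difference diag[OF that])
    qed
    have "poly_eval a (- unit_difference j G) = poly_eval (a(j := 0)) G - poly_eval (a(j := 1)) G"
      by (simp add: poly_eval_unit_difference)
    also have "\<dots> = (\<Sum>q\<leftarrow>qs. (poly_eval (c 1) q)\<^sup>2)"
      using ev[OF bool, of 1] by (simp add: cX cY)
    also have "\<dots> = (\<Sum>p\<leftarrow>map r qs. (poly_eval a p)\<^sup>2)"
      by (simp add: o_def r cong: map_cong)
    finally show "poly_eval a (- unit_difference j G) = (\<Sum>p\<leftarrow>map r qs. (poly_eval a p)\<^sup>2)" .
  qed
qed

text \<open>Each step of the telescoping path is \<open>y\<^sub>j - x\<^sub>j = (y\<^sub>j - x\<^sub>j)\<^sup>2\<close> times the given sum of squares at a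
  point whose coordinates are among the variables \<open>x\<^sub>k\<close> and \<open>y\<^sub>k\<close>, so the degree rises by one only.\<close>

lemma sos_differences_imp_sos_antitone:
  assumes G: "multilinear G" "vars G \<subseteq> {1..n} - {i}"
    and sos: "\<And>j. j \<in> {1..n} - {i} \<Longrightarrow> sos_mod (vars2 n j i) t (I2 n j i) (- unit_difference j G)"
  shows "sos_mod (vars1 n i) (t + 1) (I1 n i)
      (poly_subst (\<lambda>k. Var (X k)) G - poly_subst (\<lambda>k. Var (Y k)) G)"
proof -
  have "\<forall>j\<in>{1..n} - {i}. \<exists>qs. (\<forall>q\<in>set qs. vars q \<subseteq> vars2 n j i \<and> total_degree q \<le> t) \<and>
      (\<forall>a. (\<forall>k\<in>vars2 n j i. (a k)\<^sup>2 = a k) \<longrightarrow>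
        poly_eval a (- unit_difference j G) = (\<Sum>q\<leftarrow>qs. (poly_eval a q)\<^sup>2))"
    using sos unfolding sos_mod_I2_iff by blast
  then obtain qs where
    "\<forall>j\<in>{1..n} - {i}. (\<forall>q\<in>set (qs j). vars q \<subseteq> vars2 n j i \<and> total_degree q \<le> t) \<and>
      (\<forall>a. (\<forall>k\<in>vars2 n j i. (a k)\<^sup>2 = a k) \<longrightarrow>
        poly_eval a (- unit_difference j G) = (\<Sum>q\<leftarrow>qs j. (poly_eval a q)\<^sup>2))"
    by (rule bchoice[THEN exE])
  then have
    qs: "\<And>j q. j \<in> {1..n} - {i} \<Longrightarrow> q \<in> set (qs j) \<Longrightarrow> vars q \<subseteq> vars2 n j i \<and> total_degree q \<le> t"
    and ev: "\<And>j a. j \<in> {1..n} - {i} \<Longrightarrow> \<forall>k\<in>vars2 n j i. (a k)\<^sup>2 = a k \<Longrightarrow>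
        poly_eval a (- unit_difference j G) = (\<Sum>q\<leftarrow>qs j. (poly_eval a q)\<^sup>2)"
    by blast+
  have concat: "sum_list (map g (concat (map h ks))) = (\<Sum>k\<leftarrow>ks. sum_list (map g (h k)))"
    for g :: "xy rpoly \<Rightarrow> real" and h :: "nat \<Rightarrow> xy rpoly list" and ks
    by (induction ks) simp_all
  define js where "js = sorted_list_of_set ({1..n} - {i})"
  have js: "set js = {1..n} - {i}" "distinct js" by (simp_all add: js_def)
  define s :: "nat \<Rightarrow> nat \<Rightarrow> xy rpoly" where "s j k = (if k < j then Var (Y k) else Var (X k))" for j k
  define r where "r j q = (Var (Y j) - Var (X j)) * poly_subst (s j) q" for j q
  show ?thesis
    unfolding sos_mod_I1_iff
  proof (intro conjI exI ballI allI impI)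
    show "vars (poly_subst (\<lambda>k. Var (X k)) G - poly_subst (\<lambda>k. Var (Y k)) G) \<subseteq> vars1 n i"
      using G(2) by (intro vars_diffI vars_substI) (auto simp: vars1_def)
  next
    fix p assume "p \<in> set (concat (map (\<lambda>j. map (r j) (qs j)) js))"
    then obtain j where "j \<in> set js" and "p \<in> set (map (r j) (qs j))" by auto
    then obtain q where j: "j \<in> {1..n} - {i}" and q: "q \<in> set (qs j)" and p: "p = r j q"
      unfolding js(1) by (auto simp only: set_map)
    note Q = qs[OF j q]
    have "X j \<in> vars1 n i" "Y j \<in> vars1 n i" using j by (auto simp: vars1_def)
    moreover have "vars (s j k) \<subseteq> vars1 n i" if "k \<in> vars q" for k
      using Q that by (auto simp: s_def vars1_def vars2_def)
    ultimately show "vars p \<subseteq> vars1 n i"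
      unfolding p r_def by (intro vars_multI vars_diffI vars_substI) simp_all
    have "total_degree (r j q) \<le> 1 + t"
      unfolding r_def using Q
      by (intro total_degree_mult_le total_degree_diff_le total_degree_subst_le) (simp_all add: s_def)
    then show "total_degree p \<le> t + 1" by (simp add: p)
  next
    fix a assume a: "ordered_boolean ({1..n} - {i}) a"
    define z where "z j = (\<lambda>k. if k < j then a (Y k) else a (X k))" for j
    have z: "(\<lambda>k. poly_eval a (s j k)) = z j" for j
      by (auto simp: s_def z_def)
    have summand: "(a (X j) - a (Y j)) * poly_eval (z j) (unit_difference j G) =
        (\<Sum>q\<leftarrow>qs j. (poly_eval a (r j q))\<^sup>2)" if j: "j \<in> {1..n} - {i}" for j
    proof -
      have "(a (X j))\<^sup>2 = a (X j)" "a (X j) * a (Y j) = a (X j)" "(a (Y j))\<^sup>2 = a (Y j)"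
        using a j unfolding ordered_boolean_def by blast+
      then have sq: "(a (Y j) - a (X j))\<^sup>2 = a (Y j) - a (X j)"
        by (auto simp: power2_eq_square)
      have "\<forall>k\<in>vars2 n j i. (z j k)\<^sup>2 = z j k"
        using a by (auto simp: ordered_boolean_def vars2_def z_def)
      then have "- poly_eval (z j) (unit_difference j G) = (\<Sum>q\<leftarrow>qs j. (poly_eval (z j) q)\<^sup>2)"
        using ev[OF j] by simp
      moreover have "(a (X j) - a (Y j)) * poly_eval (z j) (unit_difference j G) =
          (a (Y j) - a (X j))\<^sup>2 * (- poly_eval (z j) (unit_difference j G))"
        unfolding sq by (simp add: algebra_simps)
      ultimately have "(a (X j) - a (Y j)) * poly_eval (z j) (unit_difference j G) =
          (a (Y j) - a (X j))\<^sup>2 * (\<Sum>q\<leftarrow>qs j. (poly_eval (z j) q)\<^sup>2)"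
        by (simp only:)
      also have "\<dots> = (\<Sum>q\<leftarrow>qs j. (poly_eval a (r j q))\<^sup>2)"
        by (simp add: r_def poly_eval_subst z sum_list_const_mult power_mult_distrib)
      finally show ?thesis .
    qed
    have "unit_difference i G = 0"
      using G(2) by (auto simp: unit_difference_def vars_def intro!: sum.neutral)
    then have zero: "(a (X j) - a (Y j)) * poly_eval (z j) (unit_difference j G) = 0"
      if "j \<in> {1..n} - ({1..n} - {i})" for j
      using that by auto
    have "poly_eval a (poly_subst (\<lambda>k. Var (X k)) G - poly_subst (\<lambda>k. Var (Y k)) G) =
        (\<Sum>j=1..n. (a (X j) - a (Y j)) * poly_eval (z j) (unit_difference j G))"
      using poly_eval_telescope[OF G(1), of n "\<lambda>k. a (X k)" "\<lambda>k. a (Y k)"] G(2)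
      by (auto simp: poly_eval_subst z_def)
    also have "\<dots> = (\<Sum>j\<in>{1..n} - {i}. (a (X j) - a (Y j)) * poly_eval (z j) (unit_difference j G))"
      using zero by (intro sum.mono_neutral_right) auto
    also have "\<dots> = (\<Sum>j\<in>set js. \<Sum>q\<leftarrow>qs j. (poly_eval a (r j q))\<^sup>2)"
      unfolding js(1) by (intro sum.cong refl summand)
    also have "\<dots> = (\<Sum>p\<leftarrow>concat (map (\<lambda>j. map (r j) (qs j)) js). (poly_eval a p)\<^sup>2)"
      using js(2) by (simp add: sum_list_distinct_conv_sum_set[symmetric] concat o_def)
    finally show "poly_eval a (poly_subst (\<lambda>k. Var (X k)) G - poly_subst (\<lambda>k. Var (Y k)) G) =
        (\<Sum>p\<leftarrow>concat (map (\<lambda>j. map (r j) (qs j)) js). (poly_eval a p)\<^sup>2)" .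
  qed
qed

theorem theorem1:
  fixes t n :: nat and f :: "nat set \<Rightarrow> real"
  shows "sos_submodular t n f \<longleftrightarrow>
    (\<forall>i\<in>{1..n}. sos_mod (vars1 n i) (t + 1) (I1 n i)
       (poly_subst (\<lambda>k. Var (X k)) (partial_deriv i (mle n f))
        - poly_subst (\<lambda>k. Var (Y k)) (partial_deriv i (mle n f))))"
proof -
  have F: "multilinear (mle n f)" "vars (mle n f) \<subseteq> {1..n}"
    using is_mle_mle[of n f] by (simp_all add: is_mle_def)
  define G where "G i = partial_deriv i (mle n f)" for i
  have G: "multilinear (G i)" "vars (G i) \<subseteq> {1..n} - {i}" for i
    using F vars_unit_difference[of i "mle n f"]
    by (auto simp: G_def partial_deriv_multilinear multilinear_unit_difference)
  have "sos_submodular t n f \<longleftrightarrow> (\<forall>i\<in>{1..n}. \<forall>j\<in>{1..n} - {i}.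
      sos_mod (vars2 n j i) t (I2 n j i) (- unit_difference j (G i)))"
    unfolding sos_submodular_def G_def[symmetric] partial_deriv_multilinear[OF G(1)] by blast
  then show ?thesis
    unfolding G_def[symmetric]
    using sos_antitone_imp_sos_differences[OF G] sos_differences_imp_sos_antitone[OF G] by blast
qed

end
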